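(* Each of the following two decision problems can be solved in time polynomial in the size of $\mathscr{A}$: given a synchronizing automaton $\mathscr{A}$ with $L=\mathrm{Syn}(\mathscr{A})$, (1) decide whether $rc(L)=1$; (2) decide whether $rc(L)=2$.
   Context: A deterministic finite automaton (DFA, or simply automaton) here is a triple $\mathscr{A}=\langle Q,\Sigma,\delta\rangle$ with $Q$ a finite nonempty state set, $\Sigma$ a finite alphabet and $\delta:Q\times\Sigma\to Q$ a total transition function, extended in the usual way to $\delta:Q\times\Sigma^*\to Q$. A word $w\in\Sigma^*$ is reset for $\mathscr{A}$ if $\delta(q,w)=\delta(q',w)$ for all $q,q'\in Q$; $\mathscr{A}$ is synchronizing if it has a reset word. $\mathrm{Syn}(\mathscr{A})\subseteq\Sigma^*$ is the set of all reset words of $\mathscr{A}$. It is a regular language and an ideal, i.e. $\mathrm{Syn}(\mathscr{A})=\Sigma^*\mathrm{Syn}(\mathscr{A})\Sigma^*$. The reset complexity $rc(L)$ of a (nonempty) regular ideal language $L\subseteq\Sigma^*$ is the minimal number of states of a synchronizing automaton $\mathscr{B}$ over $\Sigma$ with $\mathrm{Syn}(\mathscr{B})=L$. The ideal language $L$ is presented by the automaton $\mathscr{A}$, given by its transition table. *)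

theory Defs
  imports "HOL-Computational_Algebra.Polynomial"
begin

section \<open>Automata, reset words and reset complexity\<close>

record ('q, 'a) automaton =
  states :: "'q set"
  alphabet :: "'a set"
  trans :: "'q \<Rightarrow> 'a \<Rightarrow> 'q"

definition dfa :: "('q, 'a) automaton \<Rightarrow> bool" where
  "dfa A \<longleftrightarrow> finite (states A) \<and> states A \<noteq> {} \<and> finite (alphabet A) \<and>
     (\<forall>q\<in>states A. \<forall>a\<in>alphabet A. trans A q a \<in> states A)"

definition trans_word :: "('q, 'a) automaton \<Rightarrow> 'q \<Rightarrow> 'a list \<Rightarrow> 'q" where
  "trans_word A q w = foldl (trans A) q w"

definition Syn :: "('q, 'a) automaton \<Rightarrow> 'a list set" where
  "Syn A = {w \<in> lists (alphabet A).
     \<forall>q\<in>states A. \<forall>q'\<in>states A. trans_word A q w = trans_word A q' w}"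

definition synchronizing :: "('q, 'a) automaton \<Rightarrow> bool" where
  "synchronizing A \<longleftrightarrow> Syn A \<noteq> {}"

text \<open>
  Every finite automaton is isomorphic to one whose states are natural numbers, so letting the
  competing automata have states in \<^typ>\<open>nat\<close> loses no generality. The value is meaningful only
  if some competing automaton exists, which is the case for \<open>L = Syn A\<close> with \<open>A\<close> synchronizing.
\<close>

definition rc :: "'a set \<Rightarrow> 'a list set \<Rightarrow> nat" where
  "rc S L = (LEAST m. \<exists>B :: (nat, 'a) automaton.
     dfa B \<and> alphabet B = S \<and> synchronizing B \<and> Syn B = L \<and> card (states B) = m)"


section \<open>Polynomial time\<close>

text \<open>
  The machine model is the random access machine of Cook and Reckhow, over the natural numbers
  (subtraction is truncated). An input is a finite sequence of numbers read one after the other;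
  reading past the end yields 0. There is no multiplication, so each instruction lengthens the
  largest number present by at most one bit (or brings in an input number or a constant of the
  program). Hence counting instructions measures time up to a polynomial as on a Turing machine.
\<close>

datatype instr =
    Const nat nat
  | Add nat nat nat
  | Sub nat nat nat
  | Load nat nat
  | Store nat nat
  | Jump_pos nat nat
  | Read nat

text \<open>A configuration: program counter, registers, unread part of the input.\<close>

type_synonym config = "nat \<times> (nat \<Rightarrow> nat) \<times> nat list"

fun exec_instr :: "instr \<Rightarrow> config \<Rightarrow> config" where
  "exec_instr (Const i c) (pc, m, x) = (Suc pc, m(i := c), x)"
| "exec_instr (Add i j k) (pc, m, x) = (Suc pc, m(i := m j + m k), x)"
| "exec_instr (Sub i j k) (pc, m, x) = (Suc pc, m(i := m j - m k), x)"
| "exec_instr (Load i j) (pc, m, x) = (Suc pc, m(i := m (m j)), x)"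
| "exec_instr (Store i j) (pc, m, x) = (Suc pc, m(m i := m j), x)"
| "exec_instr (Jump_pos l j) (pc, m, x) = (if m j > 0 then l else Suc pc, m, x)"
| "exec_instr (Read i) (pc, m, x) =
     (Suc pc, m(i := (case x of [] \<Rightarrow> 0 | y # _ \<Rightarrow> y)), tl x)"

definition halted :: "instr list \<Rightarrow> config \<Rightarrow> bool" where
  "halted P c \<longleftrightarrow> fst c \<ge> length P"

definition step :: "instr list \<Rightarrow> config \<Rightarrow> config" where
  "step P c = (if halted P c then c else exec_instr (P ! fst c) c)"

definition initial :: "nat list \<Rightarrow> config" where
  "initial x = (0, (\<lambda>_. 0), x)"

text \<open>The answer of a halted machine is the content of register 0: 1 for yes, 0 for no.\<close>

definition answers_within :: "instr list \<Rightarrow> nat \<Rightarrow> nat list \<Rightarrow> bool \<Rightarrow> bool" where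
  "answers_within P t x b \<longleftrightarrow> (\<exists>s\<le>t. \<exists>pc m y. (step P ^^ s) (initial x) = (pc, m, y) \<and>
     halted P (pc, m, y) \<and> m 0 = (if b then 1 else 0))"

text \<open>
  A decision problem with set of instances \<open>I\<close>, encoding \<open>code\<close> of instances and question \<open>R\<close>;
  nothing is required of the program on inputs that do not encode an instance.
\<close>

definition poly_time_decidable :: "'i set \<Rightarrow> ('i \<Rightarrow> nat list) \<Rightarrow> ('i \<Rightarrow> bool) \<Rightarrow> bool" where
  "poly_time_decidable I code R \<longleftrightarrow> (\<exists>P :: instr list. \<exists>p :: nat poly.
     \<forall>A\<in>I. answers_within P (poly p (length (code A))) (code A) (R A))"


section \<open>Automata given by transition tables\<close>

text \<open>
  In a transition table, states (rows) and letters (columns) are numbered from 0. The code has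
  \<open>2 + |Q| |\<Sigma>|\<close> entries. For synchronizing automata all of them are at most the length of the
  code: if the alphabet is empty, there is only one state. So this length is, up to a polynomial,
  the number of bits of the table.
\<close>

definition tabulated :: "(nat, nat) automaton \<Rightarrow> bool" where
  "tabulated A \<longleftrightarrow> states A = {..<card (states A)} \<and> alphabet A = {..<card (alphabet A)}"

definition table_code :: "(nat, nat) automaton \<Rightarrow> nat list" where
  "table_code A = card (states A) # card (alphabet A) #
     concat (map (\<lambda>q. map (trans A q) [0..<card (alphabet A)]) [0..<card (states A)])"

definition sync_automata :: "(nat, nat) automaton set" where
  "sync_automata = {A. dfa A \<and> synchronizing A \<and> tabulated A}"

end

theory Submission
  imports Defs
begin

text \<open>
  \<^term>\<open>rc (alphabet A) (Syn A) = 1\<close> means that the empty word is reset, i.e. that \<open>A\<close> has one state.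
  On two states a letter acts as a permutation or as a constant, so a two-state automaton
  resets precisely the words that contain a reset letter. Hence the reset complexity is 2 iff no
  word over the letters that are not reset resets \<open>A\<close> (which excludes the empty word as well). As
  for synchronizability, this fails iff every pair of states can be merged by such a word. The
  mergeable pairs are found by backward closure of the diagonal, for which
  \<open>n\<^sup>2 + 1\<close> rounds over all pairs and letters suffice.
\<close>

section \<open>A structured language for the random access machine\<close>

datatype com = Block "instr list" | Seq com com (infixr ";;" 60) | For nat nat com

text \<open>A loop adds three instructions in front of its body and four behind it.\<close>

fun com_length :: "com \<Rightarrow> nat" where
  "com_length (Block is) = length is"
| "com_length (c1 ;; c2) = com_length c1 + com_length c2"
| "com_length (For i l c) = com_length c + 7"

text \<open>
  \<open>For i l c\<close> runs \<open>c\<close> with register \<open>i\<close> counting from 0 up to the content of register \<open>l\<close>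
  (exclusive). Register 1 is scratch space of all loops.
\<close>

fun compile :: "nat \<Rightarrow> com \<Rightarrow> instr list" where
  "compile pc (Block is) = is"
| "compile pc (c1 ;; c2) = compile pc c1 @ compile (pc + com_length c1) c2"
| "compile pc (For i l c) =
     [Const i 0, Const 1 1, Jump_pos (pc + com_length c + 5) 1] @ compile (pc + 3) c @
     [Const 1 1, Add i i 1, Sub 1 l i, Jump_pos (pc + 3) 1]"

lemma length_compile [simp]: "length (compile pc c) = com_length c"
  by (induction c arbitrary: pc) auto

section \<open>Timed Hoare logic for structured commands\<close>

type_synonym assn = "(nat \<Rightarrow> nat) \<Rightarrow> nat list \<Rightarrow> bool"

definition reaches :: "instr list \<Rightarrow> nat \<Rightarrow> config \<Rightarrow> nat \<Rightarrow> assn \<Rightarrow> bool" where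
  "reaches P t c pc Q \<longleftrightarrow> (\<exists>s\<le>t. \<exists>m x. (step P ^^ s) c = (pc, m, x) \<and> Q m x)"

lemma reaches_0: "Q m x \<Longrightarrow> reaches P t (pc, m, x) pc Q"
  unfolding reaches_def by (intro exI[of _ 0]) auto

lemma reaches_trans:
  assumes "reaches P t1 c pc R"
    and "\<And>m x. R m x \<Longrightarrow> reaches P t2 (pc, m, x) pc' Q"
  shows "reaches P (t1 + t2) c pc' Q"
proof -
  obtain s1 m x where 1: "s1 \<le> t1" "(step P ^^ s1) c = (pc, m, x)" "R m x"
    using assms(1) unfolding reaches_def by auto
  obtain s2 m' x' where 2: "s2 \<le> t2" "(step P ^^ s2) (pc, m, x) = (pc', m', x')" "Q m' x'"
    using assms(2)[OF 1(3)] unfolding reaches_def by auto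
  have "(step P ^^ (s2 + s1)) c = (pc', m', x')"
    using 1 2 by (simp add: funpow_add)
  then show ?thesis
    unfolding reaches_def using 1 2 by (intro exI[of _ "s2 + s1"]) auto
qed

lemma reaches_step:
  assumes "fst c < length P" "exec_instr (P ! fst c) c = c'" "reaches P t c' pc Q"
  shows "reaches P (Suc t) c pc Q"
proof -
  obtain s m x where s: "s \<le> t" "(step P ^^ s) c' = (pc, m, x)" "Q m x"
    using assms(3) unfolding reaches_def by auto
  have "step P c = c'"
    using assms by (simp add: step_def halted_def)
  then have "(step P ^^ Suc s) c = (pc, m, x)"
    using s by (simp add: funpow_Suc_right del: funpow.simps)
  then show ?thesis
    unfolding reaches_def using s by (intro exI[of _ "Suc s"]) auto
qed

lemma reaches_mono: "reaches P t c pc Q \<Longrightarrow> t \<le> t' \<Longrightarrow> reaches P t' c pc Q"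
  unfolding reaches_def by (meson le_trans)

text \<open>Jump targets are absolute, so a triple quantifies over the surrounding code
  \<open>pre\<close> and \<open>post\<close>; this lets it be used at any position of a larger
  program. The bound \<open>t\<close> makes it a total correctness statement.\<close>

definition hoare :: "assn \<Rightarrow> nat \<Rightarrow> com \<Rightarrow> assn \<Rightarrow> bool" where
  "hoare P t c Q \<longleftrightarrow> (\<forall>pre post m x. P m x \<longrightarrow>
     reaches (pre @ compile (length pre) c @ post) t (length pre, m, x)
       (length pre + com_length c) Q)"

lemma hoareD:
  assumes "hoare P t c Q" "P m x" "prog = pre @ compile (length pre) c @ post"
    "pc = length pre" "pc' = length pre + com_length c"
  shows "reaches prog t (pc, m, x) pc' Q"
  using assms unfolding hoare_def by blast

lemma hoare_conseq:
  assumes "hoare P' t' c Q'"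
    and "\<And>m x. P m x \<Longrightarrow> P' m x" "\<And>m x. Q' m x \<Longrightarrow> Q m x" "t' \<le> t"
  shows "hoare P t c Q"
  using assms unfolding hoare_def reaches_def by (meson le_trans)

lemma hoare_seq:
  assumes c1: "hoare P t1 c1 R" and c2: "hoare R t2 c2 Q"
  shows "hoare P (t1 + t2) (c1 ;; c2) Q"
  unfolding hoare_def
proof (intro allI impI)
  fix pre post :: "instr list" and m x
  assume "P m x"
  let ?prog = "pre @ compile (length pre) (c1 ;; c2) @ post"
  have "reaches ?prog t1 (length pre, m, x) (length pre + com_length c1) R"
    by (rule hoareD[OF c1, OF \<open>P m x\<close>]) auto
  moreover have "reaches ?prog t2 (length pre + com_length c1, m', x')
      (length pre + com_length (c1 ;; c2)) Q" if "R m' x'" for m' x'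
    \<comment> \<open>For \<open>c2\<close> the code of \<open>c1\<close> belongs to the
      prefix.\<close>
    by (rule hoareD[OF c2, OF that, where pre = "pre @ compile (length pre) c1"]) auto
  ultimately show "reaches ?prog (t1 + t2) (length pre, m, x)
      (length pre + com_length (c1 ;; c2)) Q"
    by (rule reaches_trans)
qed

section \<open>Straight-line code\<close>

fun is_jump :: "instr \<Rightarrow> bool" where
  "is_jump (Jump_pos _ _) = True"
| "is_jump _ = False"

fun run :: "instr list \<Rightarrow> (nat \<Rightarrow> nat) \<times> nat list \<Rightarrow> (nat \<Rightarrow> nat) \<times> nat list" where
  "run [] s = s"
| "run (i # is) (m, x) = run is (snd (exec_instr i (0, m, x)))"

lemma run_append: "run (is @ is') s = run is' (run is s)"
  by (induction "is" s rule: run.induct) auto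

text \<open>Without jumps the effect on registers and input does not depend on the program counter,
  which is why \<open>run\<close> may use the dummy counter 0.\<close>

lemma exec_no_jump:
  "\<not> is_jump i \<Longrightarrow> exec_instr i (pc, m, x) = (Suc pc, snd (exec_instr i (0, m, x)))"
  by (cases i) auto

lemma hoare_block:
  assumes "list_all (\<lambda>i. \<not> is_jump i) is" and "length is \<le> t"
    and "\<And>m x. P m x \<Longrightarrow> case_prod Q (run is (m, x))"
  shows "hoare P t (Block is) Q"
proof -
  have "reaches (pre @ is @ post) (length is) (length pre, m, x) (length pre + length is) Q"
    if "case_prod Q (run is (m, x))" for pre post m x
    using that assms(1)
  proof (induction "is" arbitrary: pre m x)
    case Nil
    then show ?case by (simp add: reaches_0)
  next
    case (Cons i "is")
    obtain m' x' where mx: "snd (exec_instr i (0, m, x)) = (m', x')"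
      by (cases "snd (exec_instr i (0, m, x))")
    have i: "exec_instr i (length pre, m, x) = (Suc (length pre), m', x')"
      using exec_no_jump[of i "length pre" m x] Cons.prems(2) mx by simp
    have "case_prod Q (run is (m', x'))"
      using Cons.prems(1) mx by simp
    \<comment> \<open>The executed instruction moves to the prefix, so the induction hypothesis
      covers the rest of the block.\<close>
    then have "reaches ((pre @ [i]) @ is @ post) (length is) (length (pre @ [i]), m', x')
        (length (pre @ [i]) + length is) Q"
      by (rule Cons.IH) (use Cons.prems(2) in simp)
    then show ?case
      using i by (auto intro: reaches_step simp: nth_append)
  qed
  note block = this
  show ?thesis
    unfolding hoare_def compile.simps com_length.simps
    by (intro allI impI reaches_mono[OF block assms(2)] assms(3))
qed

text \<open>Each round costs the test (2 steps), the body and the increment (2 steps); the remaining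
  5 steps are the entry (3) and the last, failing test. The frame conditions hold the invariant
  stable while the loop overwrites its counter and register 1.\<close>

lemma hoare_for:
  assumes body: "\<And>j. j < N \<Longrightarrow> hoare (\<lambda>m x. I j m x \<and> m i = j \<and> m l = N) t c
      (\<lambda>m x. I (Suc j) m x \<and> m i = j \<and> m l = N)"
    and frame: "\<And>j m x v. I j m x \<Longrightarrow> I j (m(i := v)) x"
      "\<And>j m x v. I j m x \<Longrightarrow> I j (m(1 := v)) x"
    and regs: "i \<noteq> 1" "l \<noteq> 1" "i \<noteq> l"
    and pre: "\<And>m x. P m x \<Longrightarrow> I 0 m x \<and> m l = N"
    and post: "\<And>m x. I N m x \<Longrightarrow> m l = N \<Longrightarrow> Q m x"
  shows "hoare P (N * (t + 4) + 5) (For i l c) Q"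
  unfolding hoare_def
proof (intro allI impI)
  fix pre post :: "instr list" and m x
  assume "P m x"
  then have start: "I 0 m x" "m l = N"
    using pre by auto
  define prog where "prog = pre @ compile (length pre) (For i l c) @ post"
  define pc where "pc = length pre"
  define body_pc where "body_pc = pc + 3"
  define incr_pc where "incr_pc = body_pc + com_length c"
  define test_pc where "test_pc = incr_pc + 2"
  define end_pc where "end_pc = incr_pc + 4"
  note pcs = body_pc_def incr_pc_def test_pc_def end_pc_def pc_def
  have succ: "Suc (Suc (Suc pc)) = body_pc" "Suc (Suc incr_pc) = test_pc"
    "Suc (Suc test_pc) = end_pc"
    by (simp_all add: pcs)
  have len: "end_pc \<le> length prog" "pc < body_pc" "incr_pc < test_pc" "test_pc < end_pc"
    "body_pc \<le> incr_pc"
    by (simp_all add: prog_def pcs)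
  have nth: "prog ! pc = Const i 0" "prog ! Suc pc = Const 1 1"
    "prog ! Suc (Suc pc) = Jump_pos test_pc 1"
    "prog ! incr_pc = Const 1 1" "prog ! Suc incr_pc = Add i i 1"
    "prog ! test_pc = Sub 1 l i" "prog ! Suc test_pc = Jump_pos body_pc 1"
    by (auto simp: prog_def nth_append pcs nth_Cons' numeral_eq_Suc)
  have lens: "pc < length prog" "Suc pc < length prog" "Suc (Suc pc) < length prog"
    "incr_pc < length prog" "Suc incr_pc < length prog"
    "test_pc < length prog" "Suc test_pc < length prog"
    using len succ by linarith+
  note exec = reaches_step[OF _ refl]
  \<comment> \<open>Induction on the number of remaining rounds. It starts at the test, which the
    entry code jumps to unconditionally, so that a loop with bound 0 skips its body.\<close>
  have loop: "reaches prog ((N - j) * (t + 4) + 2) (test_pc, m, x) end_pc Q"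
    if "j \<le> N" "I j m x" "m i = j" "m l = N" for j m x
    using that
  proof (induction "N - j" arbitrary: j m x)
    case 0
    then have "Q (m(1 := 0)) x"
      using frame(2) regs post by auto
    then have "reaches prog (Suc (Suc 0)) (test_pc, m, x) end_pc Q"
      using 0 regs by (intro exec) (auto simp: nth lens succ intro: reaches_0)
    then show ?case
      using 0 by (simp add: numeral_2_eq_2)
  next
    case (Suc d)
    then have j: "j < N" "N - j = Suc d" "d = N - Suc j" by simp_all
    \<comment> \<open>The test leaves \<open>N - j\<close> in register 1; it is positive here, so
      the jump to the body is taken.\<close>
    have "reaches prog t (body_pc, m(1 := N - j), x) incr_pc
        (\<lambda>m x. I (Suc j) m x \<and> m i = j \<and> m l = N)"
    proof (rule hoareD[OF body[OF j(1)]])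
      show "prog = (pre @ [Const i 0, Const 1 1, Jump_pos test_pc 1]) @
          compile (length (pre @ [Const i 0, Const 1 1, Jump_pos test_pc 1])) c @
          ([Const 1 1, Add i i 1, Sub 1 l i, Jump_pos body_pc 1] @ post)"
        by (simp add: prog_def pcs numeral_3_eq_3)
      show "I j (m(1 := N - j)) x \<and> (m(1 := N - j)) i = j \<and> (m(1 := N - j)) l = N"
        using Suc.prems frame(2) regs by simp
    qed (simp_all add: pcs)
    moreover have "reaches prog (Suc (Suc (d * (t + 4) + 2))) (incr_pc, m', x') end_pc Q"
      if "I (Suc j) m' x' \<and> m' i = j \<and> m' l = N" for m' x'
    proof -
      have "reaches prog (d * (t + 4) + 2) (test_pc, m'(1 := 1, i := Suc j), x') end_pc Q"
        using Suc.hyps(1)[of "Suc j" "m'(1 := 1, i := Suc j)" x'] that j(1,3) regs frame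
        by simp
      then show ?thesis
        using that regs by (intro exec) (simp_all add: nth lens succ)
    qed
    ultimately have "reaches prog (t + Suc (Suc (d * (t + 4) + 2))) (body_pc, m(1 := N - j), x)
        end_pc Q"
      by (rule reaches_trans)
    then have "reaches prog (Suc (Suc (t + Suc (Suc (d * (t + 4) + 2))))) (test_pc, m, x) end_pc Q"
      using regs Suc.prems j by (intro exec) (simp_all add: nth lens succ)
    then show ?case
      unfolding j(2) by (rule reaches_mono) simp
  qed
  have "reaches prog (N * (t + 4) + 2) (test_pc, m(i := 0, 1 := 1), x) end_pc Q"
    using loop[of 0 "m(i := 0, 1 := 1)" x] start regs frame by simp
  then have "reaches prog (Suc (Suc (Suc (N * (t + 4) + 2)))) (pc, m, x) end_pc Q"
    using regs by (intro exec) (simp_all add: nth lens succ)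
  then have "reaches prog (N * (t + 4) + 5) (pc, m, x) end_pc Q"
    by (rule reaches_mono) simp
  moreover have "end_pc = length pre + com_length (For i l c)"
    by (simp add: pcs)
  ultimately show "reaches (pre @ compile (length pre) (For i l c) @ post) (N * (t + 4) + 5)
      (length pre, m, x) (length pre + com_length (For i l c)) Q"
    by (simp only: prog_def pc_def)
qed

text \<open>With no surrounding code, leaving the command means reaching the end of the program,
  hence halting.\<close>

lemma answers_within_compile:
  assumes "hoare P t c (\<lambda>m x. m 0 = (if b then 1 else 0))" and "P (\<lambda>_. 0) x"
  shows "answers_within (compile 0 c) t x b"
proof -
  have "reaches (compile 0 c) t (0, \<lambda>_. 0, x) (com_length c) (\<lambda>m x. m 0 = (if b then 1 else 0))"
    by (rule hoareD[OF assms(1), OF assms(2), where pre = "[]" and post = "[]"]) auto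
  then show ?thesis
    by (fastforce simp: reaches_def answers_within_def initial_def halted_def)
qed

section \<open>Reset complexity 1 and 2\<close>

lemma trans_word_simps [simp]:
  "trans_word A q [] = q"
  "trans_word A q (a # w) = trans_word A (trans A q a) w"
  "trans_word A q (u @ v) = trans_word A (trans_word A q u) v"
  by (auto simp: trans_word_def)

lemma trans_word_in_states:
  "dfa A \<Longrightarrow> q \<in> states A \<Longrightarrow> w \<in> lists (alphabet A) \<Longrightarrow> trans_word A q w \<in> states A"
  by (induction w arbitrary: q) (auto simp: dfa_def)

text \<open>Reading \<open>u\<close> first only leads to other states, which \<open>v\<close>
  merges, and merged states stay merged under \<open>w\<close>.\<close>

lemma Syn_ideal:
  assumes "dfa A" "v \<in> Syn A" "u \<in> lists (alphabet A)" "w \<in> lists (alphabet A)"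
  shows "u @ v @ w \<in> Syn A"
proof -
  have "trans_word A q (u @ v @ w) = trans_word A q' (u @ v @ w)"
    if "q \<in> states A" "q' \<in> states A" for q q'
  proof -
    have "trans_word A q u \<in> states A" "trans_word A q' u \<in> states A"
      using that trans_word_in_states assms(1,3) by metis+
    then have "trans_word A (trans_word A q u) v = trans_word A (trans_word A q' u) v"
      using assms(2) unfolding Syn_def by blast
    then show ?thesis
      by simp
  qed
  moreover have "v \<in> lists (alphabet A)"
    using assms(2) by (simp add: Syn_def)
  moreover from this have "u @ v @ w \<in> lists (alphabet A)"
    using assms(3,4) by (simp only: append_in_lists_conv)
  ultimately show ?thesis
    unfolding Syn_def by blast
qed

lemma Nil_in_Syn_iff: "dfa A \<Longrightarrow> [] \<in> Syn A \<longleftrightarrow> card (states A) = 1"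
  using card_le_Suc0_iff_eq[of "states A"]
  by (auto simp: Syn_def dfa_def le_Suc_eq simp flip: card_le_Suc0_iff_eq)

text \<open>The condition minimised in \<open>rc\<close>, named so that the rules for
  \<open>LEAST\<close> apply to it.\<close>

definition presentable :: "'a set \<Rightarrow> 'a list set \<Rightarrow> nat \<Rightarrow> bool" where
  "presentable S L m \<longleftrightarrow> (\<exists>B :: (nat, 'a) automaton.
     dfa B \<and> alphabet B = S \<and> synchronizing B \<and> Syn B = L \<and> card (states B) = m)"

lemma not_presentable_0: "\<not> presentable S L 0"
  by (auto simp: presentable_def dfa_def)

lemma presentable_1D: "presentable S L 1 \<Longrightarrow> [] \<in> L"
  using Nil_in_Syn_iff unfolding presentable_def by metis

lemma rc_presentable:
  fixes A :: "(nat, 'a) automaton"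
  assumes "dfa A" "synchronizing A"
  shows "presentable (alphabet A) (Syn A) (rc (alphabet A) (Syn A))"
proof -
  have "presentable (alphabet A) (Syn A) (card (states A))"
    using assms by (auto simp: presentable_def)
  then show ?thesis
    unfolding rc_def presentable_def[symmetric] by (rule LeastI)
qed

lemma rc_le: "presentable S L m \<Longrightarrow> rc S L \<le> m"
  unfolding rc_def presentable_def[symmetric] by (rule Least_le)

text \<open>Having one state is visible in the language: it amounts to the empty word being reset,
  so it is shared by all automata with the same reset words.\<close>

lemma rc_eq_1_iff:
  fixes A :: "(nat, 'a) automaton"
  assumes "dfa A" "synchronizing A"
  shows "rc (alphabet A) (Syn A) = 1 \<longleftrightarrow> card (states A) = 1"
proof
  assume "rc (alphabet A) (Syn A) = 1"
  then show "card (states A) = 1"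
    using rc_presentable[OF assms] presentable_1D Nil_in_Syn_iff[OF assms(1)] by metis
next
  assume "card (states A) = 1"
  then have "rc (alphabet A) (Syn A) \<le> 1"
    using assms by (intro rc_le) (auto simp: presentable_def)
  then show "rc (alphabet A) (Syn A) = 1"
    using rc_presentable[OF assms] not_presentable_0
    by (metis One_nat_def le_Suc_eq le_zero_eq)
qed

text \<open>On two states every letter that is not reset is a permutation.\<close>

lemma two_states_reset_letter:
  assumes "dfa B" "card (states B) = 2" "w \<in> Syn B"
  shows "\<exists>a\<in>set w. [a] \<in> Syn B"
proof (rule ccontr)
  assume none: "\<not> (\<exists>a\<in>set w. [a] \<in> Syn B)"
  have w: "w \<in> lists (alphabet B)"
    using assms(3) by (simp add: Syn_def)
  \<comment> \<open>Two distinct states are all the states there are, so a letter merging them would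
    be reset.\<close>
  have inj: "trans B q a \<noteq> trans B q' a"
    if "a \<in> set w" "q \<in> states B" "q' \<in> states B" "q \<noteq> q'" for a q q'
  proof -
    have "states B = {q, q'}"
      using that assms(1,2) by (metis card_2_iff empty_iff insert_iff doubleton_eq_iff)
    then show ?thesis
      using none that(1) w by (auto simp: Syn_def)
  qed
  have "trans_word B q u \<noteq> trans_word B q' u"
    if "q \<in> states B" "q' \<in> states B" "q \<noteq> q'" "set u \<subseteq> set w" for q q' u
    using that
  proof (induction u arbitrary: q q')
    case (Cons a u)
    then have "trans B q a \<in> states B" "trans B q' a \<in> states B"
      using assms(1) w by (auto simp: dfa_def)
    then show ?case
      using Cons inj by auto
  qed simp
  moreover obtain q q' where "q \<in> states B" "q' \<in> states B" "q \<noteq> q'"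
    using assms(2) by (auto simp: card_2_iff)
  ultimately have "trans_word B q w \<noteq> trans_word B q' w"
    by blast
  then show False
    using assms(3) \<open>q \<in> states B\<close> \<open>q' \<in> states B\<close> unfolding Syn_def by blast
qed

text \<open>Forward, the two-state argument is applied to an automaton presenting the same language;
  backward, such an automaton is constructed.\<close>

lemma rc_eq_2_iff:
  fixes A :: "(nat, 'a) automaton"
  assumes "dfa A" "synchronizing A"
  shows "rc (alphabet A) (Syn A) = 2 \<longleftrightarrow> (\<forall>w\<in>Syn A. \<exists>a\<in>set w. [a] \<in> Syn A)"
proof
  assume "rc (alphabet A) (Syn A) = 2"
  then have "presentable (alphabet A) (Syn A) 2"
    using rc_presentable[OF assms] by simp
  then show "\<forall>w\<in>Syn A. \<exists>a\<in>set w. [a] \<in> Syn A"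
    unfolding presentable_def using two_states_reset_letter by metis
next
  assume reset: "\<forall>w\<in>Syn A. \<exists>a\<in>set w. [a] \<in> Syn A"
  \<comment> \<open>Reset letters of \<open>A\<close> act as the constant 0, all other letters as
    the identity.\<close>
  define B :: "(nat, 'a) automaton" where
    "B = \<lparr>states = {0, 1}, alphabet = alphabet A, trans = (\<lambda>q a. if [a] \<in> Syn A then 0 else q)\<rparr>"
  have B: "dfa B" "alphabet B = alphabet A" "card (states B) = 2"
    using assms(1) by (auto simp: B_def dfa_def)
  have letter: "[a] \<in> Syn B \<longleftrightarrow> [a] \<in> Syn A" for a
  proof (cases "[a] \<in> Syn A")
    case True
    then have "a \<in> alphabet A"
      by (simp add: Syn_def)
    moreover have "trans B q a = 0" for q
      using True by (simp add: B_def)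
    ultimately have "[a] \<in> Syn B"
      using B(2) by (simp add: Syn_def)
    then show ?thesis
      using True by simp
  next
    case False
    then have "trans_word B 0 [a] \<noteq> trans_word B 1 [a]"
      by (simp add: B_def)
    moreover have "0 \<in> states B" "1 \<in> states B"
      by (simp_all add: B_def)
    ultimately have "[a] \<notin> Syn B"
      unfolding Syn_def by blast
    then show ?thesis
      using False by simp
  qed
  \<comment> \<open>By the ideal property a word containing a reset letter is reset; this is needed
    for both \<open>A\<close> and \<open>B\<close>.\<close>
  have "v \<in> Syn D" if "dfa D" "a \<in> set v" "[a] \<in> Syn D" "v \<in> lists (alphabet D)"
    for D :: "(nat, 'a) automaton" and v a
  proof -
    obtain u w where "v = u @ [a] @ w"
      using \<open>a \<in> set v\<close> by (auto dest: split_list)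
    then show ?thesis
      using Syn_ideal[OF that(1,3), of u w] that(4) by auto
  qed
  note mem = this
  have "Syn B = Syn A"
  proof (intro equalityI subsetI)
    fix w assume "w \<in> Syn B"
    then show "w \<in> Syn A"
      using two_states_reset_letter[OF B(1,3)] letter mem[OF assms(1)] B(2)
      by (metis (no_types, lifting) Syn_def mem_Collect_eq)
  next
    fix w assume "w \<in> Syn A"
    then show "w \<in> Syn B"
      using reset letter mem[OF B(1)] B(2)
      by (metis (no_types, lifting) Syn_def mem_Collect_eq)
  qed
  then have "rc (alphabet A) (Syn A) \<le> 2"
    using B assms(2) by (intro rc_le) (auto simp: presentable_def synchronizing_def)
  \<comment> \<open>The empty word contains no letter, so by \<open>reset\<close> it is not a reset
    word.\<close>
  moreover have "rc (alphabet A) (Syn A) \<noteq> 1"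
    using rc_presentable[OF assms] presentable_1D reset by fastforce
  moreover have "rc (alphabet A) (Syn A) \<noteq> 0"
    using rc_presentable[OF assms] not_presentable_0 by metis
  ultimately show "rc (alphabet A) (Syn A) = 2"
    by linarith
qed

section \<open>Marking mergeable pairs\<close>

lemma fold_extensive: "(\<And>i S. S \<subseteq> f i S) \<Longrightarrow> S \<subseteq> fold f xs S"
proof (induction xs arbitrary: S)
  case (Cons x xs)
  then show ?case by (metis fold_simps(2) order_trans)
qed simp

lemma fold_bounded:
  "(\<And>i S. i \<in> set xs \<Longrightarrow> S \<subseteq> M \<Longrightarrow> f i S \<subseteq> M) \<Longrightarrow> S \<subseteq> M \<Longrightarrow> fold f xs S \<subseteq> M"
  by (induction xs arbitrary: S) auto

text \<open>When the fold arrives at \<open>i\<close>, the accumulated set still contains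
  \<open>S\<close>, so \<open>z\<close> is added; later steps do not remove it.\<close>

lemma fold_reaches:
  assumes "\<And>i S. S \<subseteq> f i S" "i \<in> set xs" "\<And>S'. S \<subseteq> S' \<Longrightarrow> z \<in> f i S'"
  shows "z \<in> fold f xs S"
proof -
  obtain ys zs where xs: "xs = ys @ i # zs"
    using assms(2) by (meson split_list)
  have "z \<in> f i (fold f ys S)"
    using assms(3) fold_extensive[of f, OF assms(1)] by simp
  then show ?thesis
    using fold_extensive[of f, OF assms(1)] xs by auto
qed

locale transition_table =
  fixes n k :: nat and \<delta> :: "nat \<Rightarrow> nat \<Rightarrow> nat"
  assumes n_pos: "n > 0" and closed: "\<And>p a. p < n \<Longrightarrow> a < k \<Longrightarrow> \<delta> p a < n"
begin

text \<open>Comparison with state 0 alone lets the program test a letter with a single loop over the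
  states.\<close>

definition nonreset :: "nat \<Rightarrow> bool" where
  "nonreset a \<longleftrightarrow> (\<exists>s<n. \<delta> s a \<noteq> \<delta> 0 a)"

definition mergeable :: "(nat \<times> nat) set" where
  "mergeable = {(p, q). p < n \<and> q < n \<and>
     (\<exists>w\<in>lists {a. a < k \<and> nonreset a}. foldl \<delta> p w = foldl \<delta> q w)}"

text \<open>One backward step in the graph of pairs. Marks are updated in place, so a pair marked in
  a round can already serve later in that round. The folds below follow the loops of the program,
  which makes their partial folds loop invariants.\<close>

definition mark :: "nat \<Rightarrow> nat \<Rightarrow> nat \<Rightarrow> (nat \<times> nat) set \<Rightarrow> (nat \<times> nat) set" where
  "mark p q a S = (if nonreset a \<and> (\<delta> p a, \<delta> q a) \<in> S then insert (p, q) S else S)"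

definition mark_pair :: "nat \<Rightarrow> nat \<Rightarrow> (nat \<times> nat) set \<Rightarrow> (nat \<times> nat) set" where
  "mark_pair p q = fold (mark p q) [0..<k]"

definition mark_row :: "nat \<Rightarrow> (nat \<times> nat) set \<Rightarrow> (nat \<times> nat) set" where
  "mark_row p = fold (mark_pair p) [0..<n]"

definition mark_all :: "(nat \<times> nat) set \<Rightarrow> (nat \<times> nat) set" where
  "mark_all = fold mark_row [0..<n]"

text \<open>The parameter describes the marks after the first \<open>j\<close> rows have been
  initialised.\<close>

definition diagonal :: "nat \<Rightarrow> (nat \<times> nat) set" where
  "diagonal j = (\<lambda>p. (p, p)) ` {..<j}"

definition marked :: "(nat \<times> nat) set" where
  "marked = (mark_all ^^ (n * n + 1)) (diagonal n)"

lemma mark_extensive: "S \<subseteq> mark p q a S"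
  by (auto simp: mark_def)

lemma mark_pair_extensive: "S \<subseteq> mark_pair p q S"
  unfolding mark_pair_def by (intro fold_extensive mark_extensive)

lemma mark_row_extensive: "S \<subseteq> mark_row p S"
  unfolding mark_row_def by (intro fold_extensive mark_pair_extensive)

lemma mark_all_extensive: "S \<subseteq> mark_all S"
  unfolding mark_all_def by (intro fold_extensive mark_row_extensive)

text \<open>Putting the letter \<open>a\<close> in front of a word that merges the successors gives
  a word that merges the pair.\<close>

lemma mark_bounded:
  assumes "p < n" "q < n" "a < k" "S \<subseteq> mergeable"
  shows "mark p q a S \<subseteq> mergeable"
proof -
  have "(p, q) \<in> mergeable" if na: "nonreset a" and m: "(\<delta> p a, \<delta> q a) \<in> mergeable"
  proof -
    obtain w where "w \<in> lists {a. a < k \<and> nonreset a}" "foldl \<delta> (\<delta> p a) w = foldl \<delta> (\<delta> q a) w"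
      using m by (auto simp: mergeable_def)
    then show ?thesis
      using assms(1-3) na unfolding mergeable_def by (auto intro!: bexI[of _ "a # w"])
  qed
  then show ?thesis
    using assms(4) by (auto simp: mark_def)
qed

lemma mark_all_bounded: "S \<subseteq> mergeable \<Longrightarrow> mark_all S \<subseteq> mergeable"
  unfolding mark_all_def mark_row_def mark_pair_def
  by (intro fold_bounded mark_bounded) auto

lemma mark_all_reaches:
  assumes "p < n" "q < n" "a < k" "nonreset a" "(\<delta> p a, \<delta> q a) \<in> S"
  shows "(p, q) \<in> mark_all S"
  unfolding mark_all_def
proof (rule fold_reaches[OF mark_row_extensive])
  fix S' assume S': "S \<subseteq> S'"
  show "(p, q) \<in> mark_row p S'"
    unfolding mark_row_def
  proof (rule fold_reaches[OF mark_pair_extensive])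
    fix S'' assume S'': "S' \<subseteq> S''"
    show "(p, q) \<in> mark_pair p q S''"
      unfolding mark_pair_def
      by (rule fold_reaches[OF mark_extensive, of a]) (use assms S' S'' in \<open>auto simp: mark_def\<close>)
  qed (use assms in auto)
qed (use assms in auto)

lemma diagonal_mergeable: "diagonal n \<subseteq> mergeable"
  by (auto simp: diagonal_def mergeable_def)

text \<open>Induction on the merging word: the empty word merges only diagonal pairs, and a leading
  letter is undone by the closure condition. Contrapositively, while a mergeable pair is missing,
  some backward step yields a new pair.\<close>

lemma mergeable_subset:
  assumes "diagonal n \<subseteq> S"
    and step: "\<And>p q a. p < n \<Longrightarrow> q < n \<Longrightarrow> a < k \<Longrightarrow> nonreset a \<Longrightarrow> (\<delta> p a, \<delta> q a) \<in> S \<Longrightarrow> (p, q) \<in> S"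
  shows "mergeable \<subseteq> S"
proof -
  have "(p, q) \<in> S" if "w \<in> lists {a. a < k \<and> nonreset a}" "p < n" "q < n"
    "foldl \<delta> p w = foldl \<delta> q w" for w p q
    using that
  proof (induction w arbitrary: p q)
    case Nil
    then show ?case using assms(1) by (auto simp: diagonal_def)
  next
    case (Cons a w)
    then show ?case by (intro step[of p q a]) (auto intro: closed)
  qed
  then show ?thesis
    by (auto simp: mergeable_def)
qed

lemma mergeable_bounded: "mergeable \<subseteq> {..<n} \<times> {..<n}"
  by (auto simp: mergeable_def)

text \<open>Until the set of marked pairs is complete, every round adds at least one pair to it.\<close>

lemma marked_eq_mergeable: "marked = mergeable"
proof -
  have fin: "finite mergeable"
    using mergeable_bounded by (rule finite_subset) auto
  have inv: "diagonal n \<subseteq> S \<and> S \<subseteq> mergeable \<and> (mergeable \<subseteq> S \<or> r \<le> card S)"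
    if "S = (mark_all ^^ r) (diagonal n)" for r S
    using that
  proof (induction r arbitrary: S)
    case 0
    then show ?case using diagonal_mergeable by auto
  next
    case (Suc r)
    define S0 where "S0 = (mark_all ^^ r) (diagonal n)"
    have S: "S = mark_all S0"
      using Suc.prems by (simp add: S0_def)
    have IH: "diagonal n \<subseteq> S0" "S0 \<subseteq> mergeable" "mergeable \<subseteq> S0 \<or> r \<le> card S0"
      using Suc.IH[OF S0_def] by auto
    have sub: "S0 \<subseteq> S" "S \<subseteq> mergeable"
      using mark_all_extensive mark_all_bounded IH S by auto
    have "Suc r \<le> card S" if "\<not> mergeable \<subseteq> S"
    proof -
      have not0: "\<not> mergeable \<subseteq> S0"
        using that sub by auto
      then obtain p q a where "p < n" "q < n" "a < k" "nonreset a" "(\<delta> p a, \<delta> q a) \<in> S0"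
        and new: "(p, q) \<notin> S0"
        using mergeable_subset[OF IH(1)] by blast
      then have "(p, q) \<in> S"
        using mark_all_reaches S by auto
      then have "card S0 < card S"
        using new sub fin by (intro psubset_card_mono) (auto dest: finite_subset)
      then show ?thesis
        using IH(3) not0 by simp
    qed
    then show ?case
      using IH sub by auto
  qed
  \<comment> \<open>There are only \<open>n * n\<close> pairs, so after \<open>n * n + 1\<close>
    rounds the cardinality alternative of \<open>inv\<close> is impossible.\<close>
  have "card marked \<le> card ({..<n} \<times> {..<n})"
    using inv[OF marked_def] mergeable_bounded by (intro card_mono) auto
  then show ?thesis
    using inv[OF marked_def] by auto
qed

text \<open>The pairwise criterion for synchronizability, applied to the automaton restricted to the
  letters that are not reset.\<close>

lemma all_mergeable_iff:
  "mergeable = {..<n} \<times> {..<n} \<longleftrightarrow>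
     (\<exists>w\<in>lists {a. a < k \<and> nonreset a}. \<forall>p<n. \<forall>q<n. foldl \<delta> p w = foldl \<delta> q w)"
    (is "_ \<longleftrightarrow> ?reset")
proof
  let ?\<Delta> = "{a. a < k \<and> nonreset a}"
  assume all: "mergeable = {..<n} \<times> {..<n}"
  have foldl_closed: "foldl \<delta> p w < n" if "p < n" "w \<in> lists ?\<Delta>" for p w
    using that by (induction w arbitrary: p) (auto intro: closed)
  \<comment> \<open>A common word is built for larger and larger sets of states by appending words
    that merge pairs.\<close>
  have "\<exists>w\<in>lists ?\<Delta>. \<forall>p\<in>X. \<forall>q\<in>X. foldl \<delta> p w = foldl \<delta> q w"
    if "finite X" "X \<subseteq> {..<n}" for X
    using that
  proof (induction X)
    case empty
    then show ?case by auto
  next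
    case (insert x F)
    then obtain w where w: "w \<in> lists ?\<Delta>" "\<forall>p\<in>F. \<forall>q\<in>F. foldl \<delta> p w = foldl \<delta> q w"
      by auto
    show ?case
    proof (cases "F = {}")
      case True
      then show ?thesis using w by (auto intro: bexI[of _ "[]"])
    next
      case False
      then obtain y where y: "y \<in> F" by auto
      \<comment> \<open>The word \<open>w\<close> has already collapsed \<open>F\<close> to the
        image of \<open>y\<close>; it remains to merge the image of \<open>x\<close> with
        it.\<close>
      have "(foldl \<delta> x w, foldl \<delta> y w) \<in> mergeable"
        unfolding all using insert.prems y foldl_closed[OF _ w(1)] by blast
      then obtain v where v: "v \<in> lists ?\<Delta>" "foldl \<delta> (foldl \<delta> x w) v = foldl \<delta> (foldl \<delta> y w) v"
        by (auto simp: mergeable_def)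
      have "foldl \<delta> p (w @ v) = foldl \<delta> y (w @ v)" if "p \<in> insert x F" for p
      proof (cases "p = x")
        case True
        then show ?thesis using v(2) by (simp only: foldl_append)
      next
        case False
        then have "foldl \<delta> p w = foldl \<delta> y w"
          using that y w(2) by blast
        then show ?thesis by (simp only: foldl_append)
      qed
      then have "\<forall>p\<in>insert x F. \<forall>q\<in>insert x F. foldl \<delta> p (w @ v) = foldl \<delta> q (w @ v)"
        by metis
      then show ?thesis
        by (rule bexI[of _ "w @ v"]) (use v(1) w(1) in \<open>simp only: append_in_lists_conv\<close>)
    qed
  qed
  from this[of "{..<n}"] show ?reset
    unfolding Ball_def lessThan_iff by blast
next
  assume ?reset
  then have "{..<n} \<times> {..<n} \<subseteq> mergeable"
    unfolding mergeable_def by blast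
  then show "mergeable = {..<n} \<times> {..<n}"
    using mergeable_bounded by blast
qed

end

section \<open>The program\<close>

text \<open>
  Registers 2 and 3 hold the numbers \<open>n\<close> and \<open>k\<close> of states and letters. For a state \<open>p\<close>, cell
  \<open>32 + 3 p\<close> holds the row offset \<open>3 (n + k) p\<close>, which replaces a multiplication; the entry of
  the table for state \<open>p\<close> and letter \<open>a\<close> lies at \<open>33 + 3 ((n + k) p + a)\<close>, and the mark of the pair
  \<open>(p, q)\<close> (any positive number) at \<open>34 + 3 ((n + k) p + q)\<close>. Residues modulo 3 keep the three
  regions apart. Truncated subtraction replaces branching: \<open>f - (f - y)\<close> is the minimum of \<open>f\<close> and
  \<open>y\<close>, hence positive iff both are.
\<close>

definition address :: "nat \<Rightarrow> nat \<Rightarrow> nat \<Rightarrow> instr list" where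
  "address c i j = [Add 11 i i, Add 11 11 i, Const 12 32, Add 11 11 12, Load 11 11,
     Add 11 11 j, Add 11 11 j, Add 11 11 j, Const 12 c, Add 11 11 12]"

definition lookup :: "nat \<Rightarrow> nat \<Rightarrow> nat \<Rightarrow> instr list" where
  "lookup d i j = address 33 i j @ [Load d 11]"

text \<open>The two truncated differences add up to the distance of the images of the current state
  and of state 0; register 10 sums these distances.\<close>

definition flag_prog :: com where
  "flag_prog = For 7 2 (Block (lookup 13 7 6 @ [Const 15 0] @ lookup 14 15 6 @
     [Sub 11 13 14, Sub 12 14 13, Add 10 10 11, Add 10 10 12]))"

text \<open>The old mark is increased by the minimum of the flag and the successor pair's mark:
  minimum acts as conjunction, addition as disjunction.\<close>

definition mark_prog :: com where
  "mark_prog = Block [Const 10 0] ;; flag_prog ;;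
     Block (lookup 13 4 6 @ lookup 14 5 6 @ address 34 13 14 @
       [Load 16 11, Sub 11 10 16, Sub 16 10 11] @ address 34 4 5 @
       [Load 13 11, Add 16 16 13, Store 11 16])"

definition rounds_prog :: com where
  "rounds_prog = For 8 9 (For 4 2 (For 5 2 (For 6 3 mark_prog)))"

text \<open>Register 17 holds the stride \<open>3 * (n + k)\<close>, 18 the current row offset, and
  16 points to the next table cell. Register 9 starts at 1 and gains \<open>n\<close> per row, which
  yields the round count \<open>n * n + 1\<close> without multiplication.\<close>

definition init_prog :: com where
  "init_prog = Block [Read 2, Read 3, Add 17 2 3, Add 11 17 17, Add 17 17 11, Const 9 1] ;;
     For 4 2 (
       Block [Add 11 4 4, Add 11 11 4, Const 12 32, Add 11 11 12, Store 11 18,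
         Add 11 11 18, Const 12 2, Add 11 11 12, Const 12 1, Store 11 12,
         Add 9 9 2, Const 16 33, Add 16 16 18, Add 18 18 17] ;;
       For 6 3 (Block [Read 13, Store 16 13, Const 12 3, Add 16 16 12]))"

text \<open>Register 0 counts the unmarked pairs; subtracting it twice from 1 truncates the count to
  0 or 1.\<close>

definition check_prog :: com where
  "check_prog = Block [Const 0 0] ;;
     For 4 2 (For 5 2 (Block (address 34 4 5 @
       [Load 13 11, Const 12 1, Sub 13 12 13, Add 0 0 13]))) ;;
     Block [Const 12 1, Sub 0 12 0, Sub 0 12 0]"

section \<open>Memory layout and its invariants\<close>

definition row_cell :: "nat \<Rightarrow> nat" where
  "row_cell p = 32 + 3 * p"

lemma row_cell_simps [simp]:
  "r < 32 \<Longrightarrow> row_cell p \<noteq> r" "row_cell p = row_cell p' \<longleftrightarrow> p = p'"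
  by (auto simp: row_cell_def)

context transition_table
begin

definition cell :: "nat \<Rightarrow> nat \<Rightarrow> nat \<Rightarrow> nat" where
  "cell c p q = c + 3 * ((n + k) * p + q)"

lemma cell_reg [simp]: "r < 32 \<Longrightarrow> 32 \<le> c \<Longrightarrow> cell c p q \<noteq> r"
  by (auto simp: cell_def)

text \<open>Modulo 3 the addresses are 0 for table entries, 1 for marks and 2 for row
  offsets.\<close>

lemma cell_neq [simp]:
  "cell 33 p q \<noteq> cell 34 p' q'" "cell 34 p q \<noteq> cell 33 p' q'"
  "cell 33 p q \<noteq> row_cell p'" "row_cell p' \<noteq> cell 33 p q"
  "cell 34 p q \<noteq> row_cell p'" "row_cell p' \<noteq> cell 34 p q"
  unfolding cell_def row_cell_def by presburger+

text \<open>Division by the stride \<open>n + k\<close>, which exceeds all states and letters,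
  recovers the row.\<close>

lemma cell_inj:
  assumes "q < n + k" "q' < n + k"
  shows "cell c p q = cell c p' q' \<longleftrightarrow> p = p' \<and> q = q'"
proof
  assume "cell c p q = cell c p' q'"
  then have eq: "(n + k) * p + q = (n + k) * p' + q'"
    by (simp add: cell_def)
  have "((n + k) * p + q) div (n + k) = p" "((n + k) * p' + q') div (n + k) = p'"
    using assms n_pos by simp_all
  then have "p = p'"
    using eq by simp
  then show "p = p' \<and> q = q'"
    using eq by simp
qed simp

definition rows :: "nat \<Rightarrow> (nat \<Rightarrow> nat) \<Rightarrow> bool" where
  "rows j m \<longleftrightarrow> m 2 = n \<and> m 3 = k \<and> (\<forall>p<j. m (row_cell p) = 3 * ((n + k) * p))"

text \<open>Progress of reading the table in lexicographic order: the rows before \<open>j\<close>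
  and the first \<open>b\<close> entries of row \<open>j\<close>.\<close>

definition cells :: "nat \<Rightarrow> nat \<Rightarrow> (nat \<Rightarrow> nat) \<Rightarrow> bool" where
  "cells j b m \<longleftrightarrow> (\<forall>p<n. \<forall>a<k. p < j \<or> p = j \<and> a < b \<longrightarrow> m (cell 33 p a) = \<delta> p a)"

definition marks :: "(nat \<times> nat) set \<Rightarrow> (nat \<Rightarrow> nat) \<Rightarrow> bool" where
  "marks S m \<longleftrightarrow> (\<forall>p<n. \<forall>q<n. m (cell 34 p q) > 0 \<longleftrightarrow> (p, q) \<in> S)"

definition table :: "(nat \<Rightarrow> nat) \<Rightarrow> bool" where
  "table m \<longleftrightarrow> rows n m \<and> cells n 0 m"

lemma upd_reg [simp]:
  "r < 32 \<Longrightarrow> r \<noteq> 2 \<Longrightarrow> r \<noteq> 3 \<Longrightarrow> rows j (m(r := v)) = rows j m"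
  "r < 32 \<Longrightarrow> cells j b (m(r := v)) = cells j b m"
  "r < 32 \<Longrightarrow> marks S (m(r := v)) = marks S m"
  "r < 32 \<Longrightarrow> r \<noteq> 2 \<Longrightarrow> r \<noteq> 3 \<Longrightarrow> table (m(r := v)) = table m"
  by (auto simp: rows_def cells_def marks_def table_def)

lemma upd_mark [simp]:
  "rows j (m(cell 34 p q := v)) = rows j m"
  "cells j b (m(cell 34 p q := v)) = cells j b m"
  "table (m(cell 34 p q := v)) = table m"
  by (auto simp: rows_def cells_def table_def)

lemma marks_upd:
  assumes "marks S m" "p < n" "q < n" "v > 0 \<longleftrightarrow> (p, q) \<in> S'"
    and "\<And>z. z \<noteq> (p, q) \<Longrightarrow> z \<in> S' \<longleftrightarrow> z \<in> S"
  shows "marks S' (m(cell 34 p q := v))"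
  using assms by (auto simp: marks_def cell_inj)

lemma marks_diagonal_Suc:
  "marks (diagonal j) m \<Longrightarrow> j < n \<Longrightarrow> v > 0 \<Longrightarrow> marks (diagonal (Suc j)) (m(cell 34 j j := v))"
  by (rule marks_upd[of "diagonal j"]) (auto simp: diagonal_def less_Suc_eq)

lemma upd_cell [simp]:
  "rows j (m(cell 33 p q := v)) = rows j m"
  "marks S (m(cell 33 p q := v)) = marks S m"
  by (auto simp: rows_def marks_def)

lemma upd_row [simp]:
  "cells j b (m(row_cell p := v)) = cells j b m"
  "marks S (m(row_cell p := v)) = marks S m"
  by (auto simp: cells_def marks_def)

lemma rows_Suc:
  "rows j m \<Longrightarrow> v = 3 * ((n + k) * j) \<Longrightarrow> rows (Suc j) (m(row_cell j := v))"
  by (auto simp: rows_def less_Suc_eq)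

lemma cells_Suc:
  "cells j b m \<Longrightarrow> b < k \<Longrightarrow> v = \<delta> j b \<Longrightarrow> cells j (Suc b) (m(cell 33 j b := v))"
  by (auto simp: cells_def cell_inj less_Suc_eq)

lemma cells_Suc_row: "cells j k m \<longleftrightarrow> cells (Suc j) 0 m"
  by (auto simp: cells_def less_Suc_eq)

lemma table_regs: "table m \<Longrightarrow> m 2 = n" "table m \<Longrightarrow> m 3 = k"
  by (auto simp: table_def rows_def)

lemma run_address:
  assumes "table m" "m i < n" "i \<notin> {11, 12}" "j \<notin> {11, 12}"
  shows "run (address c i j) (m, x) = (m(12 := c, 11 := cell c (m i) (m j)), x)"
proof -
  have "m (32 + 3 * m i) = 3 * ((n + k) * m i)"
    using assms(1,2) by (simp add: table_def rows_def row_cell_def)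
  then have "m (3 * m i + 32) = 3 * ((n + k) * m i)"
    by (simp add: add.commute)
  then show ?thesis
    using assms(3,4) by (auto simp: address_def fun_eq_iff cell_def)
qed

lemma run_lookup:
  assumes "table m" "m i < n" "m j < k" "i \<notin> {11, 12}" "j \<notin> {11, 12}" "d \<notin> {11, 12}"
  shows "run (lookup d i j) (m, x) =
    (m(12 := 33, 11 := cell 33 (m i) (m j), d := \<delta> (m i) (m j)), x)"
  using assms by (simp add: lookup_def run_append run_address) (simp add: table_def cells_def)

lemma no_jump_address [simp]: "list_all (\<lambda>i. \<not> is_jump i) (address c i j)"
  by (simp add: address_def)

lemma no_jump_lookup [simp]: "list_all (\<lambda>i. \<not> is_jump i) (lookup d i j)"
  by (simp add: lookup_def)

lemma length_address [simp]: "length (address c i j) = 10"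
  by (simp add: address_def)

lemma length_lookup [simp]: "length (lookup d i j) = 11"
  by (simp add: lookup_def)

section \<open>Correctness and running time of the program parts\<close>

definition pass_inv :: "(nat \<times> nat) set \<Rightarrow> nat \<Rightarrow> nat \<Rightarrow> (nat \<Rightarrow> nat) \<Rightarrow> bool" where
  "pass_inv S r l m \<longleftrightarrow> table m \<and> marks S m \<and> m 8 = r \<and> m 9 = l"

lemma pass_inv_upd [simp]:
  "r < 32 \<Longrightarrow> r \<notin> {2, 3, 8, 9} \<Longrightarrow> pass_inv S t l (m(r := v)) = pass_inv S t l m"
  by (auto simp: pass_inv_def)

lemma pass_inv_regs: "pass_inv S r l m \<Longrightarrow> m 2 = n" "pass_inv S r l m \<Longrightarrow> m 3 = k"
  by (auto simp: pass_inv_def table_regs)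

lemma hoare_flag:
  assumes "p < n" "q < n" "a < k"
  shows "hoare (\<lambda>m x. (pass_inv S r l m \<and> m 4 = p \<and> m 5 = q \<and> m 6 = a) \<and> m 10 = 0)
    (n * (27 + 4) + 5) flag_prog
    (\<lambda>m x. (pass_inv S r l m \<and> m 4 = p \<and> m 5 = q \<and> m 6 = a) \<and> (m 10 > 0 \<longleftrightarrow> nonreset a))"
  unfolding flag_prog_def
proof (rule hoare_for[where N = n and
      I = "\<lambda>j m x. (pass_inv S r l m \<and> m 4 = p \<and> m 5 = q \<and> m 6 = a) \<and>
        (m 10 > 0 \<longleftrightarrow> (\<exists>s<j. \<delta> s a \<noteq> \<delta> 0 a))"], goal_cases)
  case (1 j)
  show ?case
  proof (rule hoare_block, goal_cases)
    case (3 m x)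
    then have "table m" by (simp add: pass_inv_def)
    then show ?case
      using 3 assms n_pos \<open>j < n\<close>
      by (auto simp: run_append run_lookup table_regs less_Suc_eq)
  qed simp_all
qed (auto simp: nonreset_def pass_inv_regs)

lemma hoare_mark:
  assumes "p < n" "q < n" "a < k"
  shows "hoare (\<lambda>m x. pass_inv S r l m \<and> m 4 = p \<and> m 5 = q \<and> m 6 = a)
    (1 + (n * (27 + 4) + 5 + 48)) mark_prog
    (\<lambda>m x. pass_inv (mark p q a S) r l m \<and> m 4 = p \<and> m 5 = q \<and> m 6 = a)"
  unfolding mark_prog_def
proof (rule hoare_seq[OF hoare_block hoare_seq[OF hoare_flag[OF assms, of S r l] hoare_block]], goal_cases)
  case (6 m x)
  then have m: "table m" "marks S m" "m 4 = p" "m 5 = q" "m 6 = a" "m 10 > 0 \<longleftrightarrow> nonreset a"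
    "m 8 = r" "m 9 = l"
    by (auto simp: pass_inv_def)
  have d: "\<delta> p a < n" "\<delta> q a < n"
    using assms closed by auto
  have "m (cell 34 (\<delta> p a) (\<delta> q a)) > 0 \<longleftrightarrow> (\<delta> p a, \<delta> q a) \<in> S"
    "m (cell 34 p q) > 0 \<longleftrightarrow> (p, q) \<in> S"
    using m(2) d assms by (auto simp: marks_def)
  note mark = this
  \<comment> \<open>With flag \<open>f\<close>, successor mark \<open>y\<close> and old mark
    \<open>z\<close>, this determines when the new mark \<open>f - (f - y) + z\<close> is
    positive.\<close>
  have pos: "f - y < f + z \<longleftrightarrow> 0 < f \<and> 0 < y \<or> 0 < z" for f y z :: nat
    by arith
  show ?case
    using m(1,3-5,7,8) assms d
    by (simp add: run_append run_lookup run_address pass_inv_def)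
      (rule marks_upd[of S], auto simp: m pos mark mark_def)
qed simp_all

text \<open>From the inside outwards, each loop carries out one of the nested folds, with the fold
  over \<open>[0..<j]\<close> as invariant. Registers 8 and 9, the counter and bound of the
  outermost loop, are recorded in \<open>pass_inv\<close> because the inner loops have to preserve
  them.\<close>

lemma hoare_rounds:
  "hoare (\<lambda>m x. table m \<and> marks S m \<and> m 9 = l)
    (l * (n * (n * (k * (1 + (n * (27 + 4) + 5 + 48) + 4) + 5 + 4) + 5 + 4) + 5 + 4) + 5)
    rounds_prog (\<lambda>m x. table m \<and> marks ((mark_all ^^ l) S) m)"
proof -
  let ?tp = "1 + (n * (27 + 4) + 5 + 48)"
  have letters: "hoare (\<lambda>m x. pass_inv S r l m \<and> m 4 = p \<and> m 5 = q) (k * (?tp + 4) + 5)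
      (For 6 3 mark_prog) (\<lambda>m x. pass_inv (mark_pair p q S) r l m \<and> m 4 = p \<and> m 5 = q)"
    if "p < n" "q < n" for S r p q
  proof (rule hoare_for[where N = k and
        I = "\<lambda>j m x. pass_inv (fold (mark p q) [0..<j] S) r l m \<and> m 4 = p \<and> m 5 = q"], goal_cases)
    case (1 j)
    show ?case
      by (rule hoare_conseq[OF hoare_mark[OF that 1, of "fold (mark p q) [0..<j] S" r l]])
        (auto simp: pass_inv_regs)
  qed (auto simp: pass_inv_regs mark_pair_def)
  have row: "hoare (\<lambda>m x. pass_inv S r l m \<and> m 4 = p) (n * (k * (?tp + 4) + 5 + 4) + 5)
      (For 5 2 (For 6 3 mark_prog)) (\<lambda>m x. pass_inv (mark_row p S) r l m \<and> m 4 = p)"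
    if "p < n" for S r p
  proof (rule hoare_for[where N = n and
        I = "\<lambda>j m x. pass_inv (fold (mark_pair p) [0..<j] S) r l m \<and> m 4 = p"], goal_cases)
    case (1 j)
    show ?case
      by (rule hoare_conseq[OF letters[OF that 1, of "fold (mark_pair p) [0..<j] S" r]])
        (auto simp: pass_inv_regs)
  qed (auto simp: pass_inv_regs mark_row_def)
  have pass: "hoare (\<lambda>m x. pass_inv S r l m) (n * (n * (k * (?tp + 4) + 5 + 4) + 5 + 4) + 5)
      (For 4 2 (For 5 2 (For 6 3 mark_prog))) (\<lambda>m x. pass_inv (mark_all S) r l m)" for S r
  proof (rule hoare_for[where N = n and
        I = "\<lambda>j m x. pass_inv (fold mark_row [0..<j] S) r l m"], goal_cases)
    case (1 j)
    show ?case
      by (rule hoare_conseq[OF row[OF 1, of "fold mark_row [0..<j] S" r]]) (auto simp: pass_inv_regs)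
  qed (auto simp: pass_inv_regs mark_all_def)
  show ?thesis
    unfolding rounds_prog_def
  proof (rule hoare_for[where N = l and
        I = "\<lambda>j m x. table m \<and> marks ((mark_all ^^ j) S) m"], goal_cases)
    case (1 j)
    show ?case
      by (rule hoare_conseq[OF pass[of "(mark_all ^^ j) S" j]]) (auto simp: pass_inv_def)
  qed auto
qed

lemma hoare_check:
  "hoare (\<lambda>m x. table m \<and> marks S m) (1 + (n * (n * (14 + 4) + 5 + 4) + 5 + 3)) check_prog
    (\<lambda>m x. m 0 = (if {..<n} \<times> {..<n} \<subseteq> S then 0 else 1))"
proof -
  \<comment> \<open>An unmarked pair has been met lexicographically before
    \<open>(i, j)\<close>.\<close>
  define found where "found i j \<longleftrightarrow> (\<exists>p<n. \<exists>q<n. (p < i \<or> p = i \<and> q < j) \<and> (p, q) \<notin> S)" for i j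
  let ?I = "\<lambda>i j m. (table m \<and> marks S m) \<and> (m 0 > 0 \<longleftrightarrow> found i j)"
  have row: "hoare (\<lambda>m x. ?I i 0 m \<and> m 4 = i) (n * (14 + 4) + 5)
      (For 5 2 (Block (address 34 4 5 @ [Load 13 11, Const 12 1, Sub 13 12 13, Add 0 0 13])))
      (\<lambda>m x. ?I (Suc i) 0 m \<and> m 4 = i)" if "i < n" for i
  proof (rule hoare_for[where N = n and I = "\<lambda>j m x. ?I i j m \<and> m 4 = i"],
      goal_cases)
    case (1 j)
    show ?case
    proof (rule hoare_block, goal_cases)
      case (3 m x)
      then have "m (cell 34 i j) > 0 \<longleftrightarrow> (i, j) \<in> S"
        using 1 that unfolding marks_def by blast
      then have "m (cell 34 i j) = 0 \<longleftrightarrow> (i, j) \<notin> S"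
        unfolding neq0_conv[symmetric] by blast
      moreover have "found i (Suc j) \<longleftrightarrow> found i j \<or> (i, j) \<notin> S"
        using 1 that by (auto simp: found_def less_Suc_eq)
      ultimately show ?case
        using 3 1 that by (simp add: run_append run_address table_regs)
    qed simp_all
  next
    case (8 m x)
    \<comment> \<open>The end of row \<open>i\<close> is the start of the next row.\<close>
    moreover have "found i n \<longleftrightarrow> found (Suc i) 0"
      by (auto simp: found_def less_Suc_eq)
    ultimately show ?case by simp
  qed (auto simp: table_regs)
  have all: "hoare (\<lambda>m x. ?I 0 0 m) (n * (n * (14 + 4) + 5 + 4) + 5)
     (For 4 2 (For 5 2 (Block (address 34 4 5 @
       [Load 13 11, Const 12 1, Sub 13 12 13, Add 0 0 13])))) (\<lambda>m x. ?I n 0 m)"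
  proof (rule hoare_for[where N = n and I = "\<lambda>i m x. ?I i 0 m"], goal_cases)
    case (1 i)
    show ?case
      by (rule hoare_conseq[OF row[OF 1]]) (auto simp: table_regs)
  qed (auto simp: table_regs)
  show ?thesis
    unfolding check_prog_def
  proof (rule hoare_seq[OF hoare_block hoare_seq[OF all hoare_block]], goal_cases)
    case (6 m x)
    have "found n 0 \<longleftrightarrow> \<not> {..<n} \<times> {..<n} \<subseteq> S"
      by (auto simp: found_def)
    then show ?case using 6 by (cases "m 0") simp_all
  qed (auto simp: found_def)
qed

lemma hoare_init:
  "hoare (\<lambda>m x. m = (\<lambda>_. 0) \<and> x = n # k # concat (map (\<lambda>p. map (\<delta> p) [0..<k]) [0..<n]))
    (6 + (n * (14 + (k * (4 + 4) + 5) + 4) + 5)) init_prog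
    (\<lambda>m x. table m \<and> marks (diagonal n) m \<and> m 9 = n * n + 1)"
proof -
  let ?rest = "\<lambda>i. concat (map (\<lambda>p. map (\<delta> p) [0..<k]) [i..<n])"
  let ?I = "\<lambda>j m. marks (diagonal j) m \<and> m 9 = j * n + 1 \<and> m 17 = 3 * (n + k) \<and>
    m 18 = 3 * ((n + k) * j)"
  \<comment> \<open>The block that precedes the inner loop has already dealt with row
    \<open>i\<close>, so diagonal and offsets are one row ahead of the table entries.\<close>
  have row: "hoare (\<lambda>m x. (?I (Suc i) m \<and> rows (Suc i) m \<and> cells i 0 m \<and> m 16 = cell 33 i 0 \<and>
        m 4 = i) \<and> x = ?rest i)
      (k * (4 + 4) + 5) (For 6 3 (Block [Read 13, Store 16 13, Const 12 3, Add 16 16 12]))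
      (\<lambda>m x. ?I (Suc i) m \<and> rows (Suc i) m \<and> cells (Suc i) 0 m \<and> x = ?rest (Suc i) \<and> m 4 = i)"
    if "i < n" for i
  proof (rule hoare_for[where N = k and
        I = "\<lambda>b m x. (?I (Suc i) m \<and> rows (Suc i) m \<and> cells i b m \<and> m 16 = cell 33 i b \<and>
          m 4 = i) \<and> x = map (\<delta> i) [b..<k] @ ?rest (Suc i)"], goal_cases)
    case (1 b)
    show ?case
    proof (rule hoare_block, goal_cases)
      case (3 m x)
      have "x = \<delta> i b # map (\<delta> i) [Suc b..<k] @ ?rest (Suc i)"
        using 3 1 by (simp add: upt_conv_Cons)
      moreover have "cell 33 i b + 3 = cell 33 i (Suc b)"
        by (simp add: cell_def)
      moreover have "?I (Suc i) m" "rows (Suc i) m" "cells i b m" "m 16 = cell 33 i b" "m 4 = i"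
        "m 6 = b" "m 3 = k"
        using 3 by auto
      ultimately show ?case
        using 1 by (simp add: cells_Suc)
    qed simp_all
  next
    case (7 m x)
    then show ?case
      using that by (auto simp: upt_conv_Cons rows_def)
  qed (auto simp: cells_Suc_row)
  let ?J = "\<lambda>j m x. ?I j m \<and> rows j m \<and> cells j 0 m \<and> x = ?rest j"
  show ?thesis
    unfolding init_prog_def
  proof (rule hoare_seq[where R = "?J 0"], goal_cases)
    case 1
    show ?case
    proof (rule hoare_block, goal_cases)
      case (3 m x)
      then show ?case
        by (auto simp: marks_def rows_def cells_def diagonal_def)
    qed simp_all
  next
    case 2
    show ?case
    proof (rule hoare_for[where N = n and I = ?J], goal_cases)
      case (1 i)
      show ?case
      proof (rule hoare_seq[OF hoare_block hoare_conseq[OF row[OF 1]], where R = "\<lambda>m x. (?I (Suc i) m \<and>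
            rows (Suc i) m \<and> cells i 0 m \<and> m 16 = cell 33 i 0 \<and> m 4 = i) \<and> x = ?rest i"], goal_cases)
        case (3 m x)
        then have m: "?J i m x" "m 4 = i" "m 2 = n"
          by auto
        have addresses: "i + i + i + 32 = row_cell i"
          "row_cell i + 3 * ((n + k) * i) + 2 = cell 34 i i"
          "33 + 3 * ((n + k) * i) = cell 33 i 0"
          "3 * ((n + k) * i) + 3 * (n + k) = 3 * ((n + k) * Suc i)"
          by (simp_all add: cell_def row_cell_def)
        show ?case
          using m \<open>i < n\<close> addresses by (simp add: rows_Suc marks_diagonal_Suc)
      qed (auto simp: rows_def)
    qed (auto simp: table_def rows_def)
  qed
qed

end

text \<open>The result \<open>1 - (n - 1)\<close> is 1 iff the positive number \<open>n\<close> of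
  states is 1.\<close>

definition rc1_prog :: com where
  "rc1_prog = Block [Read 1, Const 2 1, Sub 1 1 2, Sub 0 2 1]"

definition rc2_prog :: com where
  "rc2_prog = init_prog ;; rounds_prog ;; check_prog"

text \<open>Left generic in the type: over the naturals it is the step bound, and at the monomial
  \<open>[:0, 1:]\<close> it is the required polynomial.\<close>

definition rc2_time :: "'a :: comm_semiring_1 \<Rightarrow> 'a \<Rightarrow> 'a" where
  "rc2_time n k = (6 + (n * (14 + (k * (4 + 4) + 5) + 4) + 5)) +
     (((n * n + 1) * (n * (n * (k * (1 + (n * (27 + 4) + 5 + 48) + 4) + 5 + 4) + 5 + 4) + 5 + 4) + 5) +
      (1 + (n * (n * (14 + 4) + 5 + 4) + 5 + 3)))"

lemma rc2_time_mono: "n \<le> n' \<Longrightarrow> k \<le> k' \<Longrightarrow> rc2_time n k \<le> rc2_time n' k'"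
  for n k :: nat
  unfolding rc2_time_def by (intro add_mono mult_mono) auto

lemma poly_rc2_time: "poly (rc2_time [:0, 1:] [:0, 1:]) x = rc2_time x (x :: nat)"
  by (simp add: rc2_time_def)

lemma (in transition_table) hoare_rc2:
  "hoare (\<lambda>m x. m = (\<lambda>_. 0) \<and> x = n # k # concat (map (\<lambda>p. map (\<delta> p) [0..<k]) [0..<n]))
    (rc2_time n k) rc2_prog
    (\<lambda>m x. m 0 = (if mergeable = {..<n} \<times> {..<n} then 0 else 1))"
proof -
  have "{..<n} \<times> {..<n} \<subseteq> marked \<longleftrightarrow> mergeable = {..<n} \<times> {..<n}"
    using marked_eq_mergeable mergeable_bounded by auto
  note check = hoare_check[of marked, unfolded this]
  have rounds: "hoare (\<lambda>m x. table m \<and> marks (diagonal n) m \<and> m 9 = n * n + 1)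
    ((n * n + 1) * (n * (n * (k * (1 + (n * (27 + 4) + 5 + 48) + 4) + 5 + 4) + 5 + 4) + 5 + 4) + 5)
    rounds_prog (\<lambda>m x. table m \<and> marks marked m)"
    unfolding marked_def by (rule hoare_rounds)
  show ?thesis
    unfolding rc2_prog_def rc2_time_def
    by (intro hoare_seq[OF hoare_init] hoare_seq[OF rounds] check)
qed

section \<open>From transition tables back to automata\<close>

lemma transition_table_automaton:
  assumes "A \<in> sync_automata"
  shows "transition_table (card (states A)) (card (alphabet A)) (trans A)"
proof -
  have A: "dfa A" "states A = {..<card (states A)}" "alphabet A = {..<card (alphabet A)}"
    using assms by (simp_all add: sync_automata_def tabulated_def)
  show ?thesis
  proof
    show "card (states A) > 0"
      using A(1) by (auto simp: dfa_def card_gt_0_iff)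
    show "trans A p a < card (states A)" if "p < card (states A)" "a < card (alphabet A)" for p a
      using A that unfolding dfa_def by (metis lessThan_iff)
  qed
qed

lemma rc_eq_2_iff_mergeable:
  assumes "A \<in> sync_automata"
  defines "n \<equiv> card (states A)" and "k \<equiv> card (alphabet A)"
  shows "rc (alphabet A) (Syn A) = 2 \<longleftrightarrow>
    transition_table.mergeable n k (trans A) \<noteq> {..<n} \<times> {..<n}"
proof -
  interpret transition_table n k "trans A"
    unfolding n_def k_def by (rule transition_table_automaton[OF assms(1)])
  have A: "dfa A" "synchronizing A" "states A = {..<n}" "alphabet A = {..<k}"
    using assms(1) by (simp_all add: sync_automata_def tabulated_def n_def k_def)
  have Syn: "w \<in> Syn A \<longleftrightarrow> w \<in> lists {..<k} \<and>
      (\<forall>p<n. \<forall>q<n. foldl (trans A) p w = foldl (trans A) q w)" for w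
    unfolding Syn_def A(3,4) trans_word_def by blast
  have letter: "[a] \<in> Syn A \<longleftrightarrow> \<not> nonreset a" if "a < k" for a
  proof -
    have "[a] \<in> Syn A \<longleftrightarrow> (\<forall>p<n. \<forall>q<n. trans A p a = trans A q a)"
      unfolding Syn using that by simp
    also have "\<dots> \<longleftrightarrow> \<not> nonreset a"
      unfolding nonreset_def using n_pos by metis
    finally show ?thesis .
  qed
  \<comment> \<open>The words violating the criterion for reset complexity 2 are exactly the reset
    words over letters that are not reset.\<close>
  have "w \<in> Syn A \<and> (\<forall>a\<in>set w. [a] \<notin> Syn A) \<longleftrightarrow> w \<in> lists {a. a < k \<and> nonreset a} \<and>
      (\<forall>p<n. \<forall>q<n. foldl (trans A) p w = foldl (trans A) q w)" for w
  proof -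
    have "w \<in> lists {..<k} \<and> (\<forall>a\<in>set w. [a] \<notin> Syn A) \<longleftrightarrow> w \<in> lists {a. a < k \<and> nonreset a}"
      using letter by (auto simp only: in_lists_conv_set lessThan_iff mem_Collect_eq)
    then show ?thesis
      using Syn[of w] by blast
  qed
  then show ?thesis
    unfolding rc_eq_2_iff[OF A(1,2)] all_mergeable_iff by blast
qed

lemma length_table_code: "length (table_code A) = 2 + card (states A) * card (alphabet A)"
  by (simp add: table_code_def length_concat comp_def sum_list_triv)

text \<open>Over a nonempty alphabet the table has at least one entry per state. Over the empty
  alphabet the only word is empty, so a synchronizing automaton has a single state.\<close>

lemma size_le_length_table_code:
  assumes "A \<in> sync_automata"
  shows "card (states A) \<le> length (table_code A)" "card (alphabet A) \<le> length (table_code A)"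
proof -
  interpret transition_table "card (states A)" "card (alphabet A)" "trans A"
    by (rule transition_table_automaton[OF assms])
  show "card (alphabet A) \<le> length (table_code A)"
    using mult_le_mono1[of 1 "card (states A)" "card (alphabet A)"] n_pos
    unfolding length_table_code by linarith
  show "card (states A) \<le> length (table_code A)"
  proof (cases "card (alphabet A) = 0")
    case True
    have A: "dfa A" "synchronizing A"
      using assms by (simp_all add: sync_automata_def)
    then have "alphabet A = {}"
      using True by (simp add: dfa_def)
    then have "[] \<in> Syn A"
      using A(2) by (auto simp: synchronizing_def Syn_def)
    then show ?thesis
      using Nil_in_Syn_iff[OF A(1)] by (simp add: length_table_code)
  next
    case False
    then show ?thesis
      using mult_le_mono2[of 1 "card (alphabet A)" "card (states A)"]
      unfolding length_table_code by linarith
  qed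
qed

theorem lemma6:
  shows "poly_time_decidable sync_automata table_code (\<lambda>A. rc (alphabet A) (Syn A) = 1) \<and>
         poly_time_decidable sync_automata table_code (\<lambda>A. rc (alphabet A) (Syn A) = 2)"
proof
  \<comment> \<open>Four instructions suffice, whatever the input: only the number of states is
    read.\<close>
  have "answers_within (compile 0 rc1_prog) (poly [:4:] (length (table_code A))) (table_code A)
      (rc (alphabet A) (Syn A) = 1)" if "A \<in> sync_automata" for A
  proof -
    have A: "dfa A" "synchronizing A"
      using that by (simp_all add: sync_automata_def)
    have "card (states A) > 0"
      using A(1) by (auto simp: dfa_def card_gt_0_iff)
    then have "hoare (\<lambda>m x. x = table_code A) 4 rc1_prog
        (\<lambda>m x. m 0 = (if rc (alphabet A) (Syn A) = 1 then 1 else 0))"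
      unfolding rc1_prog_def rc_eq_1_iff[OF A]
      by (intro hoare_block) (auto simp: table_code_def)
    then show ?thesis
      by (auto intro: answers_within_compile)
  qed
  then show "poly_time_decidable sync_automata table_code (\<lambda>A. rc (alphabet A) (Syn A) = 1)"
    unfolding poly_time_decidable_def by blast
next
  have "answers_within (compile 0 rc2_prog)
      (poly (rc2_time [:0, 1:] [:0, 1:]) (length (table_code A))) (table_code A)
      (rc (alphabet A) (Syn A) = 2)" if "A \<in> sync_automata" for A
  proof -
    interpret transition_table "card (states A)" "card (alphabet A)" "trans A"
      by (rule transition_table_automaton[OF that])
    \<comment> \<open>The bound is monotone, so both parameters may be replaced by the length of the
      code.\<close>
    have "rc2_time (card (states A)) (card (alphabet A)) \<le>
        poly (rc2_time [:0, 1:] [:0, 1:]) (length (table_code A))"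
      unfolding poly_rc2_time by (intro rc2_time_mono size_le_length_table_code that)
    then have "hoare (\<lambda>m x. m = (\<lambda>_. 0) \<and> x = table_code A)
        (poly (rc2_time [:0, 1:] [:0, 1:]) (length (table_code A))) rc2_prog
        (\<lambda>m x. m 0 = (if rc (alphabet A) (Syn A) = 2 then 1 else 0))"
      by (intro hoare_conseq[OF hoare_rc2])
        (simp_all add: table_code_def rc_eq_2_iff_mergeable[OF that])
    then show ?thesis
      by (rule answers_within_compile) simp
  qed
  then show "poly_time_decidable sync_automata table_code (\<lambda>A. rc (alphabet A) (Syn A) = 2)"
    unfolding poly_time_decidable_def by blast
qed

end
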